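(* Suppose $r\geq1$ and that $r=m=n$ does not hold. Then the subsemigroup $\mathcal E_{mn}^J$ of $\mathcal M_{mn}^J$ generated by the set $E_J(\mathcal M_{mn}^J)$ of all idempotents of $\mathcal M_{mn}^J$ is $$\mathcal E_{mn}^J=(P\setminus D)\cup E_J(D).$$
   Context: Let $\mathbb F$ be a field, $m,n\geq1$ integers, and $r\leq\min(m,n)$. $\mathcal M_{kl}$ denotes the set of all $k\times l$ matrices over $\mathbb F$. Let $J=\begin{bmatrix}I_r&O\\O&O\end{bmatrix}\in\mathcal M_{nm}$ (an $n\times m$ matrix), and let $\mathcal M_{mn}^J$ be the semigroup with underlying set $\mathcal M_{mn}$ and operation $X\star Y=XJY$. $P=\operatorname{Reg}(\mathcal M_{mn}^J)$ is the set of all regular elements (those $X$ with $X=X\star Y\star X$ for some $Y$), and $D=\{X\in P:\operatorname{rank}(X)=r\}$. For $\Omega\subseteq\mathcal M_{mn}$, $E_J(\Omega)=\{X\in\Omega:X=X\star X\}$. *)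

theory Defs
  imports "Jordan_Normal_Form.DL_Rank"
begin

text \<open>
  Throughout, \<open>m\<close>, \<open>n\<close> and \<open>r\<close> are natural numbers with \<open>r \<le> min m n\<close>. Outside this range
  \<open>sandwich_J\<close> does not have the dimensions \<open>n \<times> m\<close>, and the definitions carry no meaning.
  The parameters are always given in the order \<open>m n r\<close>.
\<close>

definition sandwich_J :: "nat \<Rightarrow> nat \<Rightarrow> nat \<Rightarrow> 'a::field mat" where
  "sandwich_J m n r =
     four_block_mat (1\<^sub>m r)         (0\<^sub>m r (m - r))
                    (0\<^sub>m (n - r) r) (0\<^sub>m (n - r) (m - r))"

definition sandwich_mult :: "nat \<Rightarrow> nat \<Rightarrow> nat \<Rightarrow> 'a::field mat \<Rightarrow> 'a mat \<Rightarrow> 'a mat" where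
  "sandwich_mult m n r X Y = X * sandwich_J m n r * Y"

lemma sandwich_J_carrier:
  "r \<le> min m n \<Longrightarrow> sandwich_J m n r \<in> carrier_mat n m"
  by (auto simp: sandwich_J_def)

lemma sandwich_mult_closed:
  assumes "X \<in> carrier_mat m n" "Y \<in> carrier_mat m n"
  shows "sandwich_mult m n r X Y \<in> carrier_mat m n"
  using assms by (auto simp: sandwich_mult_def)

lemma sandwich_mult_assoc:
  assumes "r \<le> min m n"
    and "X \<in> carrier_mat m n" "Y \<in> carrier_mat m n" "Z \<in> carrier_mat m n"
  shows "sandwich_mult m n r (sandwich_mult m n r X Y) Z
       = sandwich_mult m n r X (sandwich_mult m n r Y Z)"
proof -
  let ?J = "sandwich_J m n r :: 'a mat"
  have J: "?J \<in> carrier_mat n m"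
    by (rule sandwich_J_carrier[OF assms(1)])
  have XJ: "X * ?J \<in> carrier_mat m m" and YJ: "Y * ?J \<in> carrier_mat m m"
    using J assms by auto
  have "X * ?J * Y * ?J * Z = X * ?J * (Y * ?J) * Z"
    using assoc_mult_mat[OF XJ assms(3) J] by simp
  also have "\<dots> = X * ?J * (Y * ?J * Z)"
    by (rule assoc_mult_mat[OF XJ YJ assms(4)])
  finally show ?thesis
    by (simp add: sandwich_mult_def)
qed

definition sandwich_Reg :: "nat \<Rightarrow> nat \<Rightarrow> nat \<Rightarrow> 'a::field mat set" where
  "sandwich_Reg m n r =
     {X \<in> carrier_mat m n. \<exists>Y \<in> carrier_mat m n.
        X = sandwich_mult m n r (sandwich_mult m n r X Y) X}"

text \<open>The first argument of \<^const>\<open>vec_space.rank\<close> is the number of rows.\<close>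

definition sandwich_D :: "nat \<Rightarrow> nat \<Rightarrow> nat \<Rightarrow> 'a::field mat set" where
  "sandwich_D m n r = {X \<in> sandwich_Reg m n r. vec_space.rank m X = r}"

definition sandwich_E :: "nat \<Rightarrow> nat \<Rightarrow> nat \<Rightarrow> 'a::field mat set \<Rightarrow> 'a mat set" where
  "sandwich_E m n r \<Omega> = {X \<in> \<Omega>. X = sandwich_mult m n r X X}"

definition sandwich_subsemigroup :: "nat \<Rightarrow> nat \<Rightarrow> nat \<Rightarrow> 'a::field mat set \<Rightarrow> bool" where
  "sandwich_subsemigroup m n r T \<longleftrightarrow>
     T \<subseteq> carrier_mat m n \<and> (\<forall>X\<in>T. \<forall>Y\<in>T. sandwich_mult m n r X Y \<in> T)"

text \<open>The hull is the intersection of all subsemigroups containing the set of idempotents.\<close>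

definition sandwich_idem_gen :: "nat \<Rightarrow> nat \<Rightarrow> nat \<Rightarrow> 'a::field mat set" where
  "sandwich_idem_gen m n r =
     sandwich_subsemigroup m n r hull sandwich_E m n r (carrier_mat m n)"

end

theory Submission
  imports Defs "Jordan_Normal_Form.DL_Rank_Submatrix"
begin

text \<open>
  Let \<open>C\<close>, \<open>R\<close> and \<open>A\<close> be the first \<open>r\<close> columns, the first \<open>r\<close> rows and the leading \<open>r \<times> r\<close> block
  of a matrix. Then \<open>X \<star> Y = C\<^sub>X R\<^sub>Y\<close>, so \<open>X\<close> is regular iff \<open>X = C E R\<close> for some \<open>E\<close>, that is, iff
  \<open>X = L A K\<close> with \<open>L\<close> and \<open>K\<close> extending the identity, and then
  \<open>(L A K) \<star> (L' A' K') = L (A A') K'\<close>. A regular \<open>X\<close> has rank \<open>r\<close> iff \<open>A\<close> is invertible, and \<open>X\<close>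
  is idempotent iff \<open>A\<close> is. Hence idempotents of rank \<open>r\<close> have \<open>A = I\<close>, which gives the inclusion from left
  to right, and the other inclusion is Erdos's theorem that every singular square matrix over a
  field is a product of idempotents.
\<close>

subsection \<open>Singular matrices as products of idempotents\<close>

text \<open>This is \<open>I + u w\<close> with \<open>w\<close> read as a row. The single family
  contains the transvections, the nonzero scalings of one coordinate and the idempotents of corank
  one.\<close>

definition elem_mat :: "nat \<Rightarrow> 'a::field vec \<Rightarrow> 'a vec \<Rightarrow> 'a mat" where
  "elem_mat n u w = mat n n (\<lambda>(i, j). (if i = j then 1 else 0) + u $ i * w $ j)"

lemma elem_mat_carrier [simp]: "elem_mat n u w \<in> carrier_mat n n"
  by (simp add: elem_mat_def)

lemma elem_mat_dim [simp]: "dim_row (elem_mat n u w) = n" "dim_col (elem_mat n u w) = n"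
  by (simp_all add: elem_mat_def)

lemma elem_mat_index:
  "i < n \<Longrightarrow> j < n \<Longrightarrow> elem_mat n u w $$ (i, j) = (if i = j then 1 else 0) + u $ i * w $ j"
  by (simp add: elem_mat_def)

lemma transpose_elem_mat: "transpose_mat (elem_mat n u w) = elem_mat n w u"
  by (rule eq_matI) (auto simp: elem_mat_def)

lemma scalar_prod_col_elem_mat:
  assumes "u \<in> carrier_vec n" "x \<in> carrier_vec n" "j < n"
  shows "x \<bullet> col (elem_mat n u w) j = x $ j + (x \<bullet> u) * w $ j"
proof -
  have "x \<bullet> col (elem_mat n u w) j
      = (\<Sum>k = 0..<n. (if k = j then x $ k else 0) + x $ k * u $ k * w $ j)"
    unfolding scalar_prod_def using assms
    by (intro sum.cong) (auto simp: elem_mat_index distrib_left mult.assoc)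
  also have "\<dots> = x $ j + (x \<bullet> u) * w $ j"
    using assms by (simp add: sum.distrib scalar_prod_def sum_distrib_right)
  finally show ?thesis .
qed

lemma mult_elem_mat_index:
  assumes "A \<in> carrier_mat m n" "u \<in> carrier_vec n" "i < m" "j < n"
  shows "(A * elem_mat n u w) $$ (i, j) = A $$ (i, j) + (row A i \<bullet> u) * w $ j"
  using assms scalar_prod_col_elem_mat[of u n "row A i" j w] by simp

lemma elem_mat_mult_index:
  assumes "A \<in> carrier_mat n m" "w \<in> carrier_vec n" "i < n" "j < m"
  shows "(elem_mat n u w * A) $$ (i, j) = A $$ (i, j) + u $ i * (w \<bullet> col A j)"
proof -
  have "(elem_mat n u w * A) $$ (i, j) = transpose_mat (elem_mat n u w * A) $$ (j, i)"
    using assms by simp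
  also have "transpose_mat (elem_mat n u w * A) = transpose_mat A * elem_mat n w u"
    using transpose_mult[OF elem_mat_carrier assms(1)] by (simp add: transpose_elem_mat)
  also have "\<dots> $$ (j, i) = A $$ (i, j) + u $ i * (w \<bullet> col A j)"
    using assms mult_elem_mat_index[of "transpose_mat A" m n w j i u]
      comm_scalar_prod[of w n "col A j"] by simp
  finally show ?thesis .
qed

lemma elem_mat_mult_elem_mat_index:
  assumes "w \<in> carrier_vec n" "x \<in> carrier_vec n" "i < n" "j < n"
  shows "(elem_mat n u w * elem_mat n x y) $$ (i, j)
       = (if i = j then 1 else 0) + x $ i * y $ j + u $ i * (w $ j + (w \<bullet> x) * y $ j)"
  using assms elem_mat_mult_index[of "elem_mat n x y" n n w i j u]
    scalar_prod_col_elem_mat[of x n w j y] by (simp add: elem_mat_index)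

text \<open>The square of \<open>I + u w\<close> is \<open>I + (2 + w \<bullet> u) u w\<close>, and
  here the coefficient is 1.\<close>

lemma elem_mat_idem:
  assumes "u \<in> carrier_vec n" "w \<in> carrier_vec n" "w \<bullet> u = -1"
  shows "elem_mat n u w * elem_mat n u w = elem_mat n u w"
  by (rule eq_matI)
     (use assms in \<open>auto simp: elem_mat_mult_elem_mat_index elem_mat_index simp del: index_mult_mat(1)\<close>)

text \<open>Sherman-Morrison formula, with \<open>v = - u / (1 + w \<bullet> u)\<close>. The inverse
  keeps the same \<open>w\<close>, so it stays in the family.\<close>

lemma elem_mat_inverse:
  assumes "u \<in> carrier_vec n" "w \<in> carrier_vec n" "w \<bullet> u \<noteq> -1"
  obtains v where "v \<in> carrier_vec n"
    "elem_mat n v w * elem_mat n u w = 1\<^sub>m n" "elem_mat n u w * elem_mat n v w = 1\<^sub>m n"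
proof
  define c where "c = 1 + w \<bullet> u"
  have c: "c \<noteq> 0" "w \<bullet> u = c - 1"
    using assms(3) by (auto simp: c_def add_eq_0_iff)
  let ?v = "(- (1 / c)) \<cdot>\<^sub>v u"
  show "?v \<in> carrier_vec n" using assms by simp
  show "elem_mat n ?v w * elem_mat n u w = 1\<^sub>m n"
    by (rule eq_matI)
       (use assms(1,2) c in \<open>auto simp: elem_mat_mult_elem_mat_index field_simps
          simp del: index_mult_mat(1)\<close>)
  show "elem_mat n u w * elem_mat n ?v w = 1\<^sub>m n"
    by (rule eq_matI)
       (use assms(1,2) c in \<open>auto simp: elem_mat_mult_elem_mat_index field_simps
          simp del: index_mult_mat(1)\<close>)
qed

section \<open>Products of idempotents and their behaviour under the factors
  \<open>I + u w\<close>\<close>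

text \<open>The inductive form lets a factorisation be lifted to the sandwich semigroup factor by
  factor.\<close>

inductive_set idem_prods :: "nat \<Rightarrow> 'a::field mat set" for n where
  idem: "E \<in> carrier_mat n n \<Longrightarrow> E * E = E \<Longrightarrow> E \<in> idem_prods n"
| mult: "A \<in> idem_prods n \<Longrightarrow> B \<in> idem_prods n \<Longrightarrow> A * B \<in> idem_prods n"

lemma idem_prods_carrier: "A \<in> idem_prods n \<Longrightarrow> A \<in> carrier_mat n n"
  by (induction rule: idem_prods.induct) auto

lemma transpose_idem_prods: "A \<in> idem_prods n \<Longrightarrow> transpose_mat A \<in> idem_prods n"
proof (induction rule: idem_prods.induct)
  case (idem E)
  then show ?case
    using transpose_mult[of E n n E n] by (intro idem_prods.idem) auto
next
  case (mult A B)
  then show ?case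
    using transpose_mult[of A n n B n] by (simp add: idem_prods_carrier idem_prods.mult)
qed

text \<open>Since \<open>(I + u w) A = A + u (w A)\<close>, the covector enters only through its
  pairings with the columns of \<open>A\<close>.\<close>

lemma elem_mat_mult_cong:
  assumes "A \<in> carrier_mat n m" "w \<in> carrier_vec n" "s \<in> carrier_vec n"
    and "\<And>j. j < m \<Longrightarrow> s \<bullet> col A j = w \<bullet> col A j"
  shows "elem_mat n u w * A = elem_mat n u s * A"
  by (rule eq_matI) (use assms in \<open>auto simp: elem_mat_mult_index simp del: index_mult_mat(1)\<close>)

text \<open>The left factor of a singular matrix only matters modulo the covectors \<open>p\<close> killing that
  matrix; this freedom turns \<open>I + u w\<close> into at most two idempotent factors.\<close>

lemma elem_mat_mult_idem_prods:
  fixes A :: "'a::field mat"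
  assumes A: "A \<in> idem_prods n" and det: "det A = 0"
    and u: "u \<in> carrier_vec n" and w: "w \<in> carrier_vec n"
  shows "elem_mat n u w * A \<in> idem_prods n"
proof -
  have Ac: "A \<in> carrier_mat n n" using A by (rule idem_prods_carrier)
  have "det (transpose_mat A) = 0" using det det_transpose[OF Ac] by simp
  then obtain p where p: "p \<in> carrier_vec n" "p \<noteq> 0\<^sub>v n" "transpose_mat A *\<^sub>v p = 0\<^sub>v n"
    using det_0_iff_vec_prod_zero_field[of "transpose_mat A" n] Ac by auto
  have pA: "p \<bullet> col A j = 0" if "j < n" for j
  proof -
    have "(transpose_mat A *\<^sub>v p) $ j = col A j \<bullet> p" using that Ac by simp
    then show ?thesis using p that Ac comm_scalar_prod[of p n "col A j"] by simp
  qed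
  have sp: "(w + c \<cdot>\<^sub>v p) \<bullet> col A j = w \<bullet> col A j" if "j < n" for j c
    using add_scalar_prod_distrib[of w n "c \<cdot>\<^sub>v p" "col A j"] w p(1) Ac pA[OF that] that by simp
  obtain l where l: "l < n" "p $ l \<noteq> 0"
    using p(1,2) by (metis carrier_vecD eq_vecI index_zero_vec(1) index_zero_vec(2))
  \<comment> \<open>If \<open>p \<bullet> u \<noteq> 0\<close>, adding a multiple of
    \<open>p\<close> to \<open>w\<close> brings its pairing with \<open>u\<close> to -1. Otherwise
    \<open>w\<close> is independent of \<open>p\<close>, which permits a detour through an auxiliary
    vector \<open>b\<close>, or it is a multiple of \<open>p\<close> and kills \<open>A\<close> as
    well.\<close>
  consider (transversal) "p \<bullet> u \<noteq> 0"
    | (independent) j where "p \<bullet> u = 0" "j < n" "p $ l * w $ j \<noteq> p $ j * w $ l"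
    | (dependent) "\<And>j. j < n \<Longrightarrow> p $ l * w $ j = p $ j * w $ l"
    by blast
  then show ?thesis
  proof cases
    case transversal
    define s where "s = w + ((-1 - w \<bullet> u) / (p \<bullet> u)) \<cdot>\<^sub>v p"
    have s: "s \<in> carrier_vec n" using w p by (simp add: s_def)
    have "s \<bullet> u = -1"
      using transversal w p(1) u add_scalar_prod_distrib[of w n _ u] by (simp add: s_def)
    then have "elem_mat n u s \<in> idem_prods n"
      using elem_mat_idem[OF u s] by (intro idem_prods.idem) auto
    moreover have "elem_mat n u w * A = elem_mat n u s * A"
      by (rule elem_mat_mult_cong[OF Ac w s]) (simp add: s_def sp)
    ultimately show ?thesis using A by (auto intro: idem_prods.mult)
  next
    case (independent j)
    \<comment> \<open>Cramer's rule on the coordinates \<open>l\<close> and \<open>j\<close>: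
      \<open>b\<close> solves \<open>w \<bullet> b = 0\<close> and \<open>p \<bullet> b = 1\<close>,
      and \<open>d\<close> is the 2x2 minor of this system. Hence \<open>p\<close> pairs to -1 with
      \<open>u - b\<close>, and \<open>w - p\<close> pairs to -1 with \<open>b\<close>.\<close>
    define d where "d = p $ l * w $ j - p $ j * w $ l"
    define b where "b = (w $ j / d) \<cdot>\<^sub>v unit_vec n l - (w $ l / d) \<cdot>\<^sub>v unit_vec n j"
    have d: "d \<noteq> 0" using independent by (simp add: d_def)
    have b: "b \<in> carrier_vec n" by (simp add: b_def)
    have sb: "x \<bullet> b = (w $ j * x $ l - w $ l * x $ j) / d" if "x \<in> carrier_vec n" for x
      using that l independent(2) scalar_prod_minus_distrib[of x n
          "(w $ j / d) \<cdot>\<^sub>v unit_vec n l" "(w $ l / d) \<cdot>\<^sub>v unit_vec n j"]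
      by (simp add: b_def diff_divide_distrib)
    have wb: "w \<bullet> b = 0" using sb[OF w] by (simp add: mult.commute)
    have pb: "p \<bullet> b = 1" using sb[OF p(1)] d by (simp add: d_def mult.commute)
    have ub: "u - b \<in> carrier_vec n" and wp: "w - p \<in> carrier_vec n" using u b w p by auto
    have 1: "elem_mat n (u - b) p \<in> idem_prods n"
      using independent(1) pb u b p(1) elem_mat_idem[OF ub p(1)]
        scalar_prod_minus_distrib[of p n u b] by (intro idem_prods.idem) auto
    have 2: "elem_mat n b (w - p) \<in> idem_prods n"
      using wb pb b p(1) w elem_mat_idem[OF b wp] minus_scalar_prod_distrib[of w n p b]
      by (intro idem_prods.idem) auto
    \<comment> \<open>The first factor gives \<open>?B = A + b (w A)\<close>, so
      \<open>p ?B = w A\<close>. The second factor then adds \<open>(u - b) (w A)\<close>, and the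
      total is \<open>A + u (w A)\<close>.\<close>
    let ?B = "elem_mat n b (w - p) * A"
    have B: "?B \<in> idem_prods n" using 2 A by (rule idem_prods.mult)
    have wpA: "(w - p) \<bullet> col A k = w \<bullet> col A k" if "k < n" for k
      using minus_scalar_prod_distrib[of w n p "col A k"] w p(1) Ac pA[OF that] that by simp
    have colB: "col ?B k = col A k + (w \<bullet> col A k) \<cdot>\<^sub>v b" if "k < n" for k
      by (rule eq_vecI) (use that Ac b wp wpA in
        \<open>auto simp: elem_mat_mult_index simp del: index_mult_mat(1) col_mult\<close>)
    have pB: "p \<bullet> col ?B k = w \<bullet> col A k" if "k < n" for k
      using colB[OF that] scalar_prod_add_distrib[of p n "col A k" "(w \<bullet> col A k) \<cdot>\<^sub>v b"]
        p(1) Ac b pA[OF that] pb that by simp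
    have "elem_mat n u w * A = elem_mat n (u - b) p * ?B"
    proof (rule eq_matI, goal_cases)
      case (1 i k)
      then have ik: "i < n" "k < n" using Ac by auto
      have "(elem_mat n (u - b) p * ?B) $$ (i, k)
          = ?B $$ (i, k) + (u $ i - b $ i) * (w \<bullet> col A k)"
        using elem_mat_mult_index[of ?B n n p i k "u - b"] idem_prods_carrier[OF B] p(1) ik pB u b
        by simp
      also have "\<dots> = A $$ (i, k) + u $ i * (w \<bullet> col A k)"
        using elem_mat_mult_index[OF Ac wp ik] wpA[OF ik(2)] by (simp add: algebra_simps)
      also have "\<dots> = (elem_mat n u w * A) $$ (i, k)"
        using elem_mat_mult_index[OF Ac w ik] by simp
      finally show ?case by simp
    qed (use Ac in auto)
    then show ?thesis using 1 B by (auto intro: idem_prods.mult)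
  next
    case dependent
    have "w = (w $ l / p $ l) \<cdot>\<^sub>v p"
      using dependent l w p(1) by (intro eq_vecI) (auto simp: field_simps)
    then have "w \<bullet> col A k = 0" if "k < n" for k
      using pA[OF that] p(1) Ac that
      by (metis carrier_matD(1) col_dim mult_zero_right smult_scalar_prod_distrib)
    then have "elem_mat n u w * A = A"
      by (intro eq_matI) (use Ac w in \<open>auto simp: elem_mat_mult_index simp del: index_mult_mat(1)\<close>)
    then show ?thesis using A by simp
  qed
qed

text \<open>Transposition exchanges \<open>u\<close> and \<open>w\<close> and preserves both
  singularity and \<open>idem_prods\<close>, which reduces this to the left-handed version.\<close>

lemma idem_prods_mult_elem_mat:
  fixes A :: "'a::field mat"
  assumes A: "A \<in> idem_prods n" and det: "det A = 0"
    and u: "u \<in> carrier_vec n" and w: "w \<in> carrier_vec n"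
  shows "A * elem_mat n u w \<in> idem_prods n"
proof -
  have Ac: "A \<in> carrier_mat n n" using A by (rule idem_prods_carrier)
  have "elem_mat n w u * transpose_mat A \<in> idem_prods n"
    using elem_mat_mult_idem_prods[OF transpose_idem_prods[OF A] _ w u] det det_transpose[OF Ac]
    by simp
  then have "transpose_mat (A * elem_mat n u w) \<in> idem_prods n"
    using transpose_mult[OF Ac elem_mat_carrier, of u w] by (simp add: transpose_elem_mat)
  then show ?thesis using transpose_idem_prods by fastforce
qed

section \<open>Elimination without permutations and its two consequences\<close>

text \<open>Elimination that never permutes: \<open>K\<close> is the set of indices whose row and column are
  already those of the identity. If all remaining diagonal entries vanish, one row addition makes
  one of them nonzero, unless the whole remaining block vanishes and \<open>A\<close> is idempotent.\<close>

lemma elem_mat_reduction_aux: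
  fixes A :: "'a::field mat"
  assumes idem: "\<And>A. A \<in> carrier_mat n n \<Longrightarrow> A * A = A \<Longrightarrow> P A"
    and left: "\<And>A u w u'. A \<in> carrier_mat n n \<Longrightarrow> u \<in> carrier_vec n \<Longrightarrow> w \<in> carrier_vec n \<Longrightarrow>
      u' \<in> carrier_vec n \<Longrightarrow> elem_mat n u' w * elem_mat n u w = 1\<^sub>m n \<Longrightarrow>
      P (elem_mat n u w * A) \<Longrightarrow> P A"
    and right: "\<And>A u w u'. A \<in> carrier_mat n n \<Longrightarrow> u \<in> carrier_vec n \<Longrightarrow> w \<in> carrier_vec n \<Longrightarrow>
      u' \<in> carrier_vec n \<Longrightarrow> elem_mat n u w * elem_mat n u' w = 1\<^sub>m n \<Longrightarrow>
      P (A * elem_mat n u w) \<Longrightarrow> P A"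
  shows "A \<in> carrier_mat n n \<Longrightarrow>
    (\<And>i j. i < n \<Longrightarrow> j < n \<Longrightarrow> i \<in> K \<or> j \<in> K \<Longrightarrow> A $$ (i, j) = (if i = j then 1 else 0)) \<Longrightarrow> P A"
proof (induction "card ({..<n} - K)" arbitrary: A K rule: less_induct)
  case less
  note Ac = less.prems(1) and AK = less.prems(2)
  have step: "P B" if B: "B \<in> carrier_mat n n"
    and BK: "\<And>i j. i < n \<Longrightarrow> j < n \<Longrightarrow> i \<in> K \<or> j \<in> K \<Longrightarrow> B $$ (i, j) = (if i = j then 1 else 0)"
    and k: "k < n" "k \<notin> K" "B $$ (k, k) \<noteq> 0" for B k
  proof -
    define c where "c = B $$ (k, k)"
    \<comment> \<open>Left multiplication by \<open>I + u e_k\<close> turns column \<open>k\<close>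
      into the unit vector \<open>e_k\<close>: it scales the pivot to 1 and clears the rest of the
      column at once.\<close>
    define u where "u = vec n (\<lambda>i. ((if i = k then 1 else 0) - B $$ (i, k)) / c)"
    define B1 where "B1 = elem_mat n u (unit_vec n k) * B"
    have c: "c \<noteq> 0" using k by (simp add: c_def)
    have u: "u \<in> carrier_vec n" by (simp add: u_def)
    have B1: "B1 \<in> carrier_mat n n" using B by (auto simp: B1_def)
    have B1i: "B1 $$ (i, j) = B $$ (i, j) + ((if i = k then 1 else 0) - B $$ (i, k)) / c * B $$ (k, j)"
      if "i < n" "j < n" for i j
      unfolding B1_def using elem_mat_mult_index[OF B unit_vec_carrier that, of u k] that k B
      by (simp add: u_def)
    \<comment> \<open>Now that column \<open>k\<close> is \<open>e_k\<close>, a column operation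
      clears row \<open>k\<close> without touching the other rows.\<close>
    define w where "w = vec n (\<lambda>j. (if j = k then 1 else 0) - B1 $$ (k, j))"
    define B2 where "B2 = B1 * elem_mat n (unit_vec n k) w"
    have w: "w \<in> carrier_vec n" by (simp add: w_def)
    have B2: "B2 \<in> carrier_mat n n" using B1 by (auto simp: B2_def)
    have B1k: "B1 $$ (i, k) = (if i = k then 1 else 0)" if "i < n" for i
      using B1i[OF that k(1)] c by (simp add: c_def)
    have B2i: "B2 $$ (i, j) = B1 $$ (i, j) + B1 $$ (i, k) * ((if j = k then 1 else 0) - B1 $$ (k, j))"
      if "i < n" "j < n" for i j
      unfolding B2_def using mult_elem_mat_index[OF B1 unit_vec_carrier that, of k w] that k B1
      by (simp add: w_def)
    have "P B2"
    proof (rule less.hyps[of "insert k K"])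
      have "{..<n} - insert k K \<subset> {..<n} - K" using k by auto
      then show "card ({..<n} - insert k K) < card ({..<n} - K)"
        by (intro psubset_card_mono) auto
      show "B2 \<in> carrier_mat n n" by (rule B2)
      fix i j assume ij: "i < n" "j < n" "i \<in> insert k K \<or> j \<in> insert k K"
      then consider "i = k" | "j = k" | "i \<noteq> k" "j \<noteq> k" "i \<in> K \<or> j \<in> K" by auto
      then show "B2 $$ (i, j) = (if i = j then 1 else 0)"
      proof cases
        \<comment> \<open>Rows and columns from \<open>K\<close> survive: \<open>B\<close> vanishes
          at \<open>(i, k)\<close> for \<open>i \<in> K\<close> and at \<open>(k, j)\<close> for
          \<open>j \<in> K\<close>, so both corrections are zero there.\<close>
        case 3
        then show ?thesis
          using ij B2i[OF ij(1,2)] B1k[OF ij(1)] B1i[OF ij(1,2)] BK[OF ij(1,2)] BK[OF ij(1) k(1)]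
            BK[OF k(1) ij(2)] by auto
      qed (use B2i[OF ij(1,2)] B1k[OF ij(1)] B1k[OF k(1)] ij in auto)
    qed
    \<comment> \<open>Both operations are invertible: \<open>w $ k = 0\<close> because the pivot of
      \<open>B1\<close> is 1, and further below \<open>u $ k = 1 / c - 1\<close> differs from
      -1.\<close>
    have "w \<bullet> unit_vec n k \<noteq> -1" using k w B1k[OF k(1)] by (simp add: w_def)
    then obtain v where "v \<in> carrier_vec n"
      "elem_mat n (unit_vec n k) w * elem_mat n v w = 1\<^sub>m n"
      using elem_mat_inverse[OF unit_vec_carrier w] by metis
    then have "P B1" using right[OF B1 unit_vec_carrier w] \<open>P B2\<close> by (simp add: B2_def)
    have "unit_vec n k \<bullet> u \<noteq> -1" using k c u by (simp add: u_def c_def[symmetric] field_simps)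
    then obtain v where "v \<in> carrier_vec n"
      "elem_mat n v (unit_vec n k) * elem_mat n u (unit_vec n k) = 1\<^sub>m n"
      using elem_mat_inverse[OF u unit_vec_carrier] by metis
    then show "P B" using left[OF B u unit_vec_carrier] \<open>P B1\<close> by (simp add: B1_def)
  qed
  consider (diag) k where "k < n" "k \<notin> K" "A $$ (k, k) \<noteq> 0"
    | (off) i j where "i < n" "j < n" "i \<notin> K" "j \<notin> K" "A $$ (i, j) \<noteq> 0" "A $$ (j, j) = 0"
    | (zero) "\<And>i j. i < n \<Longrightarrow> j < n \<Longrightarrow> i \<notin> K \<Longrightarrow> j \<notin> K \<Longrightarrow> A $$ (i, j) = 0"
    by blast
  then show ?case
  proof cases
    case (diag k)
    then show ?thesis using step[OF Ac AK] by blast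
  next
    case (off i j)
    have ij: "i \<noteq> j" using off by auto
    \<comment> \<open>Adding row \<open>i\<close> to row \<open>j\<close> puts
      \<open>A $$ (i, j)\<close> on the diagonal at \<open>j\<close>. Row \<open>i\<close> vanishes
      in the columns of \<open>K\<close>, so these remain intact.\<close>
    define B where "B = elem_mat n (unit_vec n j) (unit_vec n i) * A"
    have B: "B \<in> carrier_mat n n" using Ac by (auto simp: B_def)
    have Bi: "B $$ (a, b) = A $$ (a, b) + (if a = j then A $$ (i, b) else 0)"
      if "a < n" "b < n" for a b
      unfolding B_def using elem_mat_mult_index[OF Ac unit_vec_carrier that, of "unit_vec n j" i]
        that off Ac by simp
    have "P B"
    proof (rule step[OF B _ off(2,4)])
      show "B $$ (j, j) \<noteq> 0" using Bi off by simp
      fix a b assume ab: "a < n" "b < n" "a \<in> K \<or> b \<in> K"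
      then show "B $$ (a, b) = (if a = b then 1 else 0)"
        using Bi[OF ab(1,2)] AK[OF ab] AK[OF off(1) ab(2)] off by auto
    qed
    have "unit_vec n i \<bullet> unit_vec n j \<noteq> (-1::'a)" using off ij by simp
    then obtain v :: "'a vec" where "v \<in> carrier_vec n"
      "elem_mat n v (unit_vec n i) * elem_mat n (unit_vec n j) (unit_vec n i) = 1\<^sub>m n"
      using elem_mat_inverse[OF unit_vec_carrier unit_vec_carrier] by metis
    then show ?thesis
      using left[OF Ac unit_vec_carrier unit_vec_carrier] \<open>P B\<close> by (simp add: B_def)
  next
    case zero
    have Ai: "A $$ (i, j) = (if i = j \<and> i \<in> K then 1 else 0)" if "i < n" "j < n" for i j
      using AK[OF that] zero[OF that] by (cases "i \<in> K \<or> j \<in> K") auto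
    let ?d = "\<lambda>i. if i \<in> K then 1 else (0::'a)"
    have "A = mat_diag n ?d"
      by (rule eq_matI) (use Ac Ai in \<open>auto simp: mat_diag_def\<close>)
    moreover have "(\<lambda>i. ?d i * ?d i) = ?d" by auto
    ultimately have "A * A = A" by (simp only: mat_diag_diag)
    then show ?thesis by (rule idem[OF Ac])
  qed
qed

text \<open>Starting from \<open>K = {}\<close> yields an induction principle for all square
  matrices: it suffices to treat idempotents and to undo an invertible factor \<open>I + u w\<close>
  on either side.\<close>

lemmas elem_mat_reduction = elem_mat_reduction_aux[where K = "{}", simplified]

text \<open>Erdos's theorem. With \<open>T\<close> the elimination factor and \<open>U\<close> its
  inverse, \<open>A = U (T A)\<close>; the matrix \<open>T A\<close> is again singular, so its
  idempotent factorisation absorbs \<open>U\<close>.\<close>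

lemma singular_imp_idem_prods:
  fixes A :: "'a::field mat"
  assumes "A \<in> carrier_mat n n" "det A = 0"
  shows "A \<in> idem_prods n"
proof -
  have "det A = 0 \<longrightarrow> A \<in> idem_prods n"
    using assms(1)
  proof (rule elem_mat_reduction[rotated -1])
    fix A :: "'a mat" assume "A \<in> carrier_mat n n" "A * A = A"
    then show "det A = 0 \<longrightarrow> A \<in> idem_prods n" by (blast intro: idem_prods.idem)
  next
    fix A :: "'a mat" and u w v :: "'a vec"
    assume *: "A \<in> carrier_mat n n" "u \<in> carrier_vec n" "w \<in> carrier_vec n" "v \<in> carrier_vec n"
      "elem_mat n v w * elem_mat n u w = 1\<^sub>m n"
      "det (elem_mat n u w * A) = 0 \<longrightarrow> elem_mat n u w * A \<in> idem_prods n"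
    show "det A = 0 \<longrightarrow> A \<in> idem_prods n"
    proof
      assume "det A = 0"
      then have d: "det (elem_mat n u w * A) = 0" using det_mult[OF elem_mat_carrier *(1)] by simp
      have "A = elem_mat n v w * (elem_mat n u w * A)"
        using assoc_mult_mat[OF elem_mat_carrier elem_mat_carrier *(1), of v w u w] * by simp
      then show "A \<in> idem_prods n"
        using elem_mat_mult_idem_prods[OF _ d *(4,3)] * d by simp
    qed
  next
    fix A :: "'a mat" and u w v :: "'a vec"
    assume *: "A \<in> carrier_mat n n" "u \<in> carrier_vec n" "w \<in> carrier_vec n" "v \<in> carrier_vec n"
      "elem_mat n u w * elem_mat n v w = 1\<^sub>m n"
      "det (A * elem_mat n u w) = 0 \<longrightarrow> A * elem_mat n u w \<in> idem_prods n"
    show "det A = 0 \<longrightarrow> A \<in> idem_prods n"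
    proof
      assume "det A = 0"
      then have d: "det (A * elem_mat n u w) = 0" using det_mult[OF *(1) elem_mat_carrier] by simp
      have "A = A * elem_mat n u w * elem_mat n v w"
        using assoc_mult_mat[OF *(1) elem_mat_carrier elem_mat_carrier, of u w v w] * by simp
      then show "A \<in> idem_prods n"
        using idem_prods_mult_elem_mat[OF _ d *(4,3)] * d by simp
    qed
  qed
  then show ?thesis using assms(2) by blast
qed

text \<open>Von Neumann regularity. An idempotent is its own inner inverse, and an inner inverse
  \<open>G\<close> of \<open>T A\<close> gives \<open>G T\<close> for \<open>A\<close>; the
  right-hand case is symmetric.\<close>

lemma inner_inverse_exists:
  fixes A :: "'a::field mat"
  assumes "A \<in> carrier_mat n n"
  shows "\<exists>G \<in> carrier_mat n n. A * G * A = A"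
  using assms
proof (rule elem_mat_reduction[rotated -1])
  fix A :: "'a mat" assume "A \<in> carrier_mat n n" "A * A = A"
  then show "\<exists>G \<in> carrier_mat n n. A * G * A = A" by metis
next
  fix A :: "'a mat" and u w v :: "'a vec"
  let ?T = "elem_mat n u w" and ?U = "elem_mat n v w"
  assume A: "A \<in> carrier_mat n n" and UT: "?U * ?T = 1\<^sub>m n"
    and "\<exists>G \<in> carrier_mat n n. ?T * A * G * (?T * A) = ?T * A"
  then obtain G where G: "G \<in> carrier_mat n n" "?T * A * G * (?T * A) = ?T * A" by blast
  have TA: "?T * A \<in> carrier_mat n n" and GT: "G * ?T \<in> carrier_mat n n"
    and AG: "A * G \<in> carrier_mat n n" using A G by auto
  have A': "?U * (?T * A) = A"
    using assoc_mult_mat[OF elem_mat_carrier elem_mat_carrier A, of v w u w] UT A by simp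
  have "A * (G * ?T) * A = A * G * (?T * A)"
    using A G(1) AG assoc_mult_mat[OF A G(1) elem_mat_carrier, of u w]
      assoc_mult_mat[OF AG elem_mat_carrier A, of u w] by simp
  also have "\<dots> = ?U * (?T * A) * G * (?T * A)" using A' by simp
  also have "\<dots> = ?U * (?T * A * G * (?T * A))"
    using assoc_mult_mat[OF elem_mat_carrier TA G(1), of v w]
      assoc_mult_mat[OF elem_mat_carrier mult_carrier_mat[OF TA G(1)] TA, of v w] by simp
  also have "\<dots> = A" using G(2) A' by simp
  finally show "\<exists>G \<in> carrier_mat n n. A * G * A = A" using GT by blast
next
  fix A :: "'a mat" and u w v :: "'a vec"
  let ?T = "elem_mat n u w" and ?U = "elem_mat n v w"
  assume A: "A \<in> carrier_mat n n" and TU: "?T * ?U = 1\<^sub>m n"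
    and "\<exists>G \<in> carrier_mat n n. A * ?T * G * (A * ?T) = A * ?T"
  then obtain G where G: "G \<in> carrier_mat n n" "A * ?T * G * (A * ?T) = A * ?T" by blast
  have AT: "A * ?T \<in> carrier_mat n n" and TG: "?T * G \<in> carrier_mat n n" using A G by auto
  have A': "A * ?T * ?U = A"
    using assoc_mult_mat[OF A elem_mat_carrier elem_mat_carrier, of u w v w] TU A by simp
  have "A * (?T * G) * A = A * ?T * G * (A * ?T * ?U)"
    using A' assoc_mult_mat[OF A elem_mat_carrier G(1), of u w] by simp
  also have "\<dots> = A * ?T * G * (A * ?T) * ?U"
    using assoc_mult_mat[OF mult_carrier_mat[OF AT G(1)] AT elem_mat_carrier, of v w] by simp
  also have "\<dots> = A" using G(2) A' by simp
  finally show "\<exists>G \<in> carrier_mat n n. A * G * A = A" using TG by blast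
qed

subsection \<open>The sandwich semigroup through leading blocks\<close>

text \<open>One definition covers the three blocks: \<open>C\<close> is
  \<open>lead_block m r\<close>, \<open>R\<close> is \<open>lead_block r n\<close> and
  \<open>A\<close> is \<open>lead_block r r\<close>.\<close>

definition lead_block :: "nat \<Rightarrow> nat \<Rightarrow> 'a mat \<Rightarrow> 'a mat" where
  "lead_block a b X = mat a b (\<lambda>(i, j). X $$ (i, j))"

lemma lead_block_carrier [simp]: "lead_block a b X \<in> carrier_mat a b"
  by (simp add: lead_block_def)

lemma lead_block_dim [simp]: "dim_row (lead_block a b X) = a" "dim_col (lead_block a b X) = b"
  by (simp_all add: lead_block_def)

lemma lead_block_index [simp]: "i < a \<Longrightarrow> j < b \<Longrightarrow> lead_block a b X $$ (i, j) = X $$ (i, j)"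
  by (simp add: lead_block_def)

lemma lead_block_id: "X \<in> carrier_mat a b \<Longrightarrow> lead_block a b X = X"
  by (rule eq_matI) auto

lemma lead_block_lead_block:
  "a \<le> c \<Longrightarrow> b \<le> d \<Longrightarrow> lead_block a b (lead_block c d X) = lead_block a b X"
  by (rule eq_matI) auto

lemma lead_block_mult:
  assumes "A \<in> carrier_mat c k" "B \<in> carrier_mat k d" "a \<le> c" "b \<le> d"
  shows "lead_block a b (A * B) = lead_block a k A * lead_block k b B"
  by (rule eq_matI) (use assms in \<open>auto simp: scalar_prod_def intro!: sum.cong\<close>)

lemma sandwich_mult_eq:
  fixes X Y :: "'a::field mat"
  assumes r: "r \<le> min m n" and X: "X \<in> carrier_mat m n" and Y: "Y \<in> carrier_mat m n"
  shows "sandwich_mult m n r X Y = lead_block m r X * lead_block r n Y"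
proof (rule eq_matI, goal_cases)
  case (1 i j)
  then have ij: "i < m" "j < n" by auto
  let ?J = "sandwich_J m n r :: 'a mat"
  have J: "?J \<in> carrier_mat n m" by (rule sandwich_J_carrier[OF r])
  have Ji: "?J $$ (l, k) = (if l = k \<and> k < r then 1 else 0)" if "l < n" "k < m" for l k
    using that r by (auto simp: sandwich_J_def)
  \<comment> \<open>Right multiplication by \<open>J\<close> keeps the first \<open>r\<close>
    columns of \<open>X\<close> and annihilates the others, which truncates the sum of the product
    at \<open>r\<close>.\<close>
  have XJ: "(X * ?J) $$ (i, k) = (if k < r then X $$ (i, k) else 0)" if "k < m" for k
  proof -
    have "(X * ?J) $$ (i, k) = (\<Sum>l = 0..<n. X $$ (i, l) * ?J $$ (l, k))"
      using that ij X J by (simp add: scalar_prod_def)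
    also have "\<dots> = (\<Sum>l = 0..<n. if l = k then (if k < r then X $$ (i, k) else 0) else 0)"
      using that by (intro sum.cong) (auto simp: Ji)
    also have "\<dots> = (if k < r then X $$ (i, k) else 0)"
      using r by simp
    finally show ?thesis .
  qed
  have "sandwich_mult m n r X Y $$ (i, j) = (\<Sum>k = 0..<m. (X * ?J) $$ (i, k) * Y $$ (k, j))"
    using ij X Y J by (simp add: sandwich_mult_def scalar_prod_def del: assoc_mult_mat)
  also have "\<dots> = (\<Sum>k = 0..<m. if k < r then X $$ (i, k) * Y $$ (k, j) else 0)"
    by (intro sum.cong) (auto simp: XJ)
  also have "\<dots> = (\<Sum>k = 0..<r. X $$ (i, k) * Y $$ (k, j))"
    using r by (intro sum.mono_neutral_cong_right) auto
  also have "\<dots> = (lead_block m r X * lead_block r n Y) $$ (i, j)"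
    using ij by (simp add: scalar_prod_def)
  finally show ?case .
qed (use X Y in \<open>auto simp: sandwich_mult_def\<close>)

section \<open>Rank bounds\<close>

text \<open>Rank is subadditive and each summand has rank at most 1. The arbitrary index set allows
  one index to be dropped from a matrix product.\<close>

lemma rank_sum_outer_products_le:
  fixes f g :: "nat \<Rightarrow> nat \<Rightarrow> 'a::field"
  assumes "finite K"
  shows "vec_space.rank m (mat m n (\<lambda>(i, j). \<Sum>k\<in>K. f i k * g k j)) \<le> card K"
  using assms
proof (induction K)
  case empty
  have "mat m n (\<lambda>(i, j). \<Sum>k\<in>{}. f i k * g k j) = 0\<^sub>m m n"
    by (rule eq_matI) auto
  then show ?case using vec_space.rank_0I[where n = m and nc = n and 'a = 'a] by (simp only: card.empty order.refl)
next
  case (insert x K)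
  let ?A = "mat m n (\<lambda>(i, j). f i x * g x j)"
  let ?B = "mat m n (\<lambda>(i, j). \<Sum>k\<in>K. f i k * g k j)"
  have "mat m n (\<lambda>(i, j). \<Sum>k\<in>insert x K. f i k * g k j) = ?A + ?B"
    by (rule eq_matI) (use insert in auto)
  moreover have "vec_space.rank m (?A + ?B) \<le> vec_space.rank m ?A + vec_space.rank m ?B"
    by (rule vec_space.rank_subadditive) auto
  moreover have "vec_space.rank m ?A \<le> 1"
    by (rule vec_space.rank_le_1_product_entries[of _ m n "\<lambda>i. f i x" "g x"]) auto
  ultimately show ?case using insert by simp
qed

lemma rank_mult_le:
  fixes P Q :: "'a::field mat"
  assumes "P \<in> carrier_mat m r" "Q \<in> carrier_mat r n"
  shows "vec_space.rank m (P * Q) \<le> r"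
proof -
  have "P * Q = mat m n (\<lambda>(i, j). \<Sum>k\<in>{0..<r}. P $$ (i, k) * Q $$ (k, j))"
    by (rule eq_matI) (use assms in \<open>auto simp: scalar_prod_def\<close>)
  then show ?thesis
    using rank_sum_outer_products_le[of "{0..<r}" m n "\<lambda>i k. P $$ (i, k)" "\<lambda>k j. Q $$ (k, j)"]
    by simp
qed

text \<open>A kernel vector \<open>v\<close> of \<open>A\<close> with
  \<open>v $ l \<noteq> 0\<close> expresses column \<open>l\<close> of \<open>P A\<close> through
  the other columns. Substituting this leaves a sum of \<open>r - 1\<close> outer products.\<close>

lemma rank_mult_singular_less:
  fixes P A Q :: "'a::field mat"
  assumes P: "P \<in> carrier_mat m r" and A: "A \<in> carrier_mat r r" and Q: "Q \<in> carrier_mat r n"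
    and det: "det A = 0"
  shows "vec_space.rank m (P * A * Q) < r"
proof -
  obtain v where v: "v \<in> carrier_vec r" "v \<noteq> 0\<^sub>v r" "A *\<^sub>v v = 0\<^sub>v r"
    using det_0_iff_vec_prod_zero_field[OF A] det by auto
  obtain l where l: "l < r" "v $ l \<noteq> 0"
    using v(1,2) by (metis carrier_vecD eq_vecI index_zero_vec(1) index_zero_vec(2))
  define B where "B = P * A"
  have B: "B \<in> carrier_mat m r" using P A by (auto simp: B_def)
  have "B *\<^sub>v v = P *\<^sub>v (A *\<^sub>v v)" using P A v(1) by (simp add: B_def)
  then have Bv: "B *\<^sub>v v = 0\<^sub>v m" using v(3) P by auto
  let ?K = "{0..<r} - {l}"
  have Bl: "B $$ (i, l) = - (\<Sum>k\<in>?K. B $$ (i, k) * v $ k) / v $ l" if "i < m" for i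
  proof -
    have "0 = (B *\<^sub>v v) $ i" using Bv that by simp
    also have "\<dots> = (\<Sum>k = 0..<r. B $$ (i, k) * v $ k)"
      using that B v(1) by (simp add: scalar_prod_def)
    also have "\<dots> = B $$ (i, l) * v $ l + (\<Sum>k\<in>?K. B $$ (i, k) * v $ k)"
      using l by (simp add: sum.remove)
    finally show ?thesis using l(2) by (simp add: field_simps eq_neg_iff_add_eq_0)
  qed
  have "B * Q = mat m n (\<lambda>(i, j). \<Sum>k\<in>?K. B $$ (i, k) * (Q $$ (k, j) - v $ k / v $ l * Q $$ (l, j)))"
  proof (rule eq_matI, goal_cases)
    case (1 i j)
    then have ij: "i < m" "j < n" by auto
    have "(B * Q) $$ (i, j) = (\<Sum>k = 0..<r. B $$ (i, k) * Q $$ (k, j))"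
      using ij B Q by (simp add: scalar_prod_def)
    also have "\<dots> = B $$ (i, l) * Q $$ (l, j) + (\<Sum>k\<in>?K. B $$ (i, k) * Q $$ (k, j))"
      using l by (simp add: sum.remove)
    also have "B $$ (i, l) * Q $$ (l, j) = (\<Sum>k\<in>?K. - (B $$ (i, k) * (v $ k / v $ l * Q $$ (l, j))))"
      unfolding Bl[OF ij(1)] sum_negf sum_divide_distrib
      by (simp add: sum_distrib_right sum_divide_distrib mult.assoc)
    also have "\<dots> + (\<Sum>k\<in>?K. B $$ (i, k) * Q $$ (k, j))
        = (\<Sum>k\<in>?K. B $$ (i, k) * (Q $$ (k, j) - v $ k / v $ l * Q $$ (l, j)))"
      unfolding sum.distrib[symmetric] by (intro sum.cong) (auto simp: algebra_simps)
    finally show ?case using ij by simp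
  qed (use B Q in auto)
  then have "vec_space.rank m (B * Q) \<le> card ?K"
    using rank_sum_outer_products_le[of ?K m n "\<lambda>i k. B $$ (i, k)"
        "\<lambda>k j. Q $$ (k, j) - v $ k / v $ l * Q $$ (l, j)"] by simp
  also have "\<dots> < r" using l by simp
  finally show ?thesis by (simp add: B_def)
qed

lemma rank_ge_lead_block:
  fixes X :: "'a::field mat"
  assumes X: "X \<in> carrier_mat m n" and r: "r \<le> min m n" and det: "det (lead_block r r X) \<noteq> 0"
  shows "r \<le> vec_space.rank m X"
proof -
  have c: "card {i. i < m \<and> i \<in> {..<r}} = r" "card {i. i < n \<and> i \<in> {..<r}} = r"
  proof -
    have "{i. i < m \<and> i \<in> {..<r}} = {..<r}" "{i. i < n \<and> i \<in> {..<r}} = {..<r}" using r by auto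
    then show "card {i. i < m \<and> i \<in> {..<r}} = r" "card {i. i < n \<and> i \<in> {..<r}} = r" by simp_all
  qed
  have "submatrix X {..<r} {..<r} = lead_block r r X"
  proof (rule eq_matI, goal_cases)
    case (1 i j)
    then have ij: "i < r" "j < r" by auto
    \<comment> \<open>In an initial segment the element of position \<open>i\<close> is
      \<open>i\<close> itself, so the submatrix is the leading block.\<close>
    then have "{a \<in> {..<r}. a < i} = {..<i}" "{a \<in> {..<r}. a < j} = {..<j}" by auto
    then show ?case
      using submatrix_index_card[of i X j "{..<r}" "{..<r}"] ij X r by simp
  qed (use X c in \<open>simp_all add: dim_submatrix\<close>)
  then show ?thesis
    using vec_space.rank_gt_minor[OF X, of "{..<r}" "{..<r}"] det c(2) by simp
qed

section \<open>Regular elements, their rank and their products\<close>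

lemma lead_block_sandwich_mult:
  fixes X Y :: "'a::field mat"
  assumes r: "r \<le> min m n" and X: "X \<in> carrier_mat m n" and Y: "Y \<in> carrier_mat m n"
    and "a \<le> m" "b \<le> n"
  shows "lead_block a b (sandwich_mult m n r X Y) = lead_block a r X * lead_block r b Y"
  using assms lead_block_mult[of "lead_block m r X" m r "lead_block r n Y" n a b]
  by (simp add: sandwich_mult_eq lead_block_lead_block)

text \<open>Only the leading block of \<open>Y\<close> enters \<open>X \<star> Y \<star> X\<close>,
  and every \<open>r\<close> by \<open>r\<close> matrix is the leading block of its padding by
  zeros.\<close>

lemma sandwich_Reg_iff:
  fixes X :: "'a::field mat"
  assumes r: "r \<le> min m n"
  shows "X \<in> sandwich_Reg m n r \<longleftrightarrow> X \<in> carrier_mat m n \<and>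
    (\<exists>E \<in> carrier_mat r r. X = lead_block m r X * E * lead_block r n X)"
proof -
  have *: "sandwich_mult m n r (sandwich_mult m n r X Y) X
      = lead_block m r X * lead_block r r Y * lead_block r n X"
    if "X \<in> carrier_mat m n" "Y \<in> carrier_mat m n" for Y
    using r lead_block_sandwich_mult[OF r that, of m r]
    by (simp add: sandwich_mult_eq[OF r sandwich_mult_closed[OF that] that(1)])
  show ?thesis
  proof
    assume "X \<in> sandwich_Reg m n r"
    then obtain Y where X: "X \<in> carrier_mat m n" and Y: "Y \<in> carrier_mat m n"
      "X = sandwich_mult m n r (sandwich_mult m n r X Y) X"
      unfolding sandwich_Reg_def by blast
    have "X = lead_block m r X * lead_block r r Y * lead_block r n X"
      using Y(2) *[OF X Y(1)] by (rule trans)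
    then show "X \<in> carrier_mat m n \<and>
        (\<exists>E \<in> carrier_mat r r. X = lead_block m r X * E * lead_block r n X)"
      using X lead_block_carrier by blast
  next
    assume "X \<in> carrier_mat m n \<and>
        (\<exists>E \<in> carrier_mat r r. X = lead_block m r X * E * lead_block r n X)"
    then obtain E where X: "X \<in> carrier_mat m n" and E: "E \<in> carrier_mat r r"
      "X = lead_block m r X * E * lead_block r n X" by blast
    define Y where "Y = mat m n (\<lambda>(i, j). if i < r \<and> j < r then E $$ (i, j) else 0)"
    have Y: "Y \<in> carrier_mat m n" by (simp add: Y_def)
    have "lead_block r r Y = E" by (rule eq_matI) (use E(1) r in \<open>auto simp: Y_def\<close>)
    then have "X = sandwich_mult m n r (sandwich_mult m n r X Y) X"
      using E(2) *[OF X Y] by (simp only:)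
    then show "X \<in> sandwich_Reg m n r"
      unfolding sandwich_Reg_def using X Y by blast
  qed
qed

lemma sandwich_Reg_carrier: "X \<in> sandwich_Reg m n r \<Longrightarrow> X \<in> carrier_mat m n"
  by (simp add: sandwich_Reg_def)

text \<open>The last two equations are the first \<open>r\<close> columns and the first
  \<open>r\<close> rows of \<open>X = C E R\<close>. Together they give
  \<open>X = (C E) A (E R)\<close>.\<close>

lemma sandwich_Reg_factors:
  fixes X :: "'a::field mat"
  assumes r: "r \<le> min m n" and "X \<in> sandwich_Reg m n r"
  obtains E where "E \<in> carrier_mat r r"
    "X = lead_block m r X * E * lead_block r n X"
    "lead_block m r X = lead_block m r X * E * lead_block r r X"
    "lead_block r n X = lead_block r r X * E * lead_block r n X"
proof -
  let ?C = "lead_block m r X" and ?R = "lead_block r n X" and ?A = "lead_block r r X"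
  obtain E where E: "E \<in> carrier_mat r r" "X = ?C * E * ?R"
    using assms sandwich_Reg_iff[OF r] by blast
  have CE: "?C * E \<in> carrier_mat m r" using mult_carrier_mat[OF lead_block_carrier E(1)] .
  have 1: "lead_block m r (?C * E * ?R) = ?C * E * ?A"
    using lead_block_mult[OF CE lead_block_carrier[of r n X], of m r] r
    by (simp add: lead_block_lead_block lead_block_id[OF CE])
  have 2: "lead_block r n (?C * E * ?R) = ?A * E * ?R"
    using lead_block_mult[OF CE lead_block_carrier[of r n X], of r n] r
      lead_block_mult[OF lead_block_carrier[of m r X] E(1), of r r]
    by (simp add: lead_block_lead_block lead_block_id[OF E(1)])
  show thesis
    by (rule that[OF E])
      (use arg_cong[OF E(2), of "lead_block m r"] 1 in \<open>rule trans\<close>,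
       use arg_cong[OF E(2), of "lead_block r n"] 2 in \<open>rule trans\<close>)
qed

text \<open>The factorisation \<open>X = (C E) A (E R)\<close> bounds the rank by \<open>r\<close>,
  strictly if \<open>A\<close> is singular; a nonsingular \<open>A\<close> is a nonzero minor of
  order \<open>r\<close>.\<close>

lemma rank_sandwich_Reg:
  fixes X :: "'a::field mat"
  assumes r: "r \<le> min m n" and X: "X \<in> sandwich_Reg m n r"
  shows "vec_space.rank m X = r \<longleftrightarrow> det (lead_block r r X) \<noteq> 0"
proof -
  let ?C = "lead_block m r X" and ?R = "lead_block r n X" and ?A = "lead_block r r X"
  obtain E where E: "E \<in> carrier_mat r r" "X = ?C * E * ?R" "?C = ?C * E * ?A" "?R = ?A * E * ?R"
    by (rule sandwich_Reg_factors[OF r X])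
  have CE: "?C * E \<in> carrier_mat m r" and ER: "E * ?R \<in> carrier_mat r n"
    using mult_carrier_mat[OF lead_block_carrier E(1)] mult_carrier_mat[OF E(1) lead_block_carrier]
    by auto
  have "vec_space.rank m X \<le> r"
    using rank_mult_le[OF CE lead_block_carrier, of n X] unfolding E(2)[symmetric] .
  moreover have X': "?C * E * ?A * (E * ?R) = X"
    unfolding E(3)[symmetric] assoc_mult_mat[OF lead_block_carrier E(1) lead_block_carrier, symmetric]
    by (rule E(2)[symmetric])
  have "vec_space.rank m X < r" if "det ?A = 0"
    using rank_mult_singular_less[OF CE lead_block_carrier ER that] unfolding X' .
  moreover have "r \<le> vec_space.rank m X" if "det ?A \<noteq> 0"
    using rank_ge_lead_block[OF sandwich_Reg_carrier[OF X] r that] .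
  ultimately show ?thesis by fastforce
qed

text \<open>Writing \<open>C = C E A\<close> and \<open>R = B F R\<close> places \<open>A B\<close>
  on both sides of the middle factor, so an inner inverse \<open>G\<close> of \<open>A B\<close>
  witnesses the regularity of \<open>C R\<close>.\<close>

lemma sandwich_Reg_mult:
  fixes X Y :: "'a::field mat"
  assumes r: "r \<le> min m n" and X: "X \<in> sandwich_Reg m n r" and Y: "Y \<in> sandwich_Reg m n r"
  shows "sandwich_mult m n r X Y \<in> sandwich_Reg m n r"
proof -
  note Xc = sandwich_Reg_carrier[OF X] and Yc = sandwich_Reg_carrier[OF Y]
  let ?C = "lead_block m r X" and ?A = "lead_block r r X"
  let ?R = "lead_block r n Y" and ?B = "lead_block r r Y"
  let ?Z = "sandwich_mult m n r X Y"
  obtain E where E: "E \<in> carrier_mat r r" "?C = ?C * E * ?A"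
    by (rule sandwich_Reg_factors[OF r X])
  obtain F where F: "F \<in> carrier_mat r r" "?R = ?B * F * ?R"
    by (rule sandwich_Reg_factors[OF r Y])
  have AB: "?A * ?B \<in> carrier_mat r r" by auto
  obtain G where G: "G \<in> carrier_mat r r" "?A * ?B * G * (?A * ?B) = ?A * ?B"
    using inner_inverse_exists[OF AB] by blast
  have assoc: "S * U * V = S * (U * V)" if "dim_col S = dim_row U" "dim_col U = dim_row V"
    for S U V :: "'a mat"
    using that by (intro assoc_mult_mat) auto
  have "?C * ?B * G * (?A * ?R) = ?C * E * ?A * ?B * G * (?A * (?B * F * ?R))"
    using arg_cong2[OF E(2) F(2), of "\<lambda>c q. c * ?B * G * (?A * q)"] .
  also have "\<dots> = ?C * E * (?A * ?B * G * (?A * ?B)) * (F * ?R)"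
    using E(1) F(1) G(1) by (simp add: assoc del: assoc_mult_mat)
  also have "\<dots> = ?C * E * ?A * (?B * F * ?R)"
    unfolding G(2) using E(1) F(1) by (simp add: assoc del: assoc_mult_mat)
  also have "\<dots> = ?Z"
    by (simp only: E(2)[symmetric] F(2)[symmetric] sandwich_mult_eq[OF r Xc Yc])
  finally have "?Z = lead_block m r ?Z * G * lead_block r n ?Z"
    using r Xc Yc by (simp add: lead_block_sandwich_mult)
  then show ?thesis
    using sandwich_Reg_iff[OF r] sandwich_mult_closed[OF Xc Yc] G(1) by blast
qed

section \<open>The candidate set is a subsemigroup\<close>

lemma idempotent_nonsingular_eq_one:
  fixes A :: "'a::field mat"
  assumes A: "A \<in> carrier_mat n n" and "det A \<noteq> 0" and idem: "A * A = A"
  shows "A = 1\<^sub>m n"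
proof -
  obtain B where B: "B \<in> carrier_mat n n" "B * A = 1\<^sub>m n"
    using det_non_zero_imp_unit[OF A assms(2), of undefined]
    by (auto simp: Units_def ring_mat_simps)
  then have "A = B * A * A" using A by simp
  also have "\<dots> = B * (A * A)" by (rule assoc_mult_mat[OF B(1) A A])
  finally show ?thesis using idem B by simp
qed

text \<open>A singular leading block of either factor makes that of the product singular. Otherwise
  both blocks are the identity, and \<open>Z \<star> Z = C_X A_Y A_X R_Y\<close> collapses to
  \<open>C_X R_Y = Z\<close>.\<close>

lemma subsemigroup_singular_or_idempotent:
  assumes r: "r \<le> min m n"
  shows "sandwich_subsemigroup m n r
    {X \<in> sandwich_Reg m n r. det (lead_block r r X) = (0::'a::field) \<or> X = sandwich_mult m n r X X}"
    (is "sandwich_subsemigroup m n r ?S")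
  unfolding sandwich_subsemigroup_def
proof (intro conjI ballI)
  show "?S \<subseteq> carrier_mat m n" by (auto simp: sandwich_Reg_carrier)
  fix X Y assume XY: "X \<in> ?S" "Y \<in> ?S"
  then have Xc: "X \<in> carrier_mat m n" and Yc: "Y \<in> carrier_mat m n"
    by (auto simp: sandwich_Reg_carrier)
  let ?Z = "sandwich_mult m n r X Y"
  note Zc = sandwich_mult_closed[OF Xc Yc, of r]
  have Z: "?Z \<in> sandwich_Reg m n r" using XY sandwich_Reg_mult[OF r] by blast
  have one: "lead_block r r W = 1\<^sub>m r" if "W \<in> ?S" "det (lead_block r r W) \<noteq> 0" for W
  proof (rule idempotent_nonsingular_eq_one[OF lead_block_carrier that(2)])
    have "W = sandwich_mult m n r W W" and "W \<in> carrier_mat m n"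
      using that by (auto simp: sandwich_Reg_carrier)
    then show "lead_block r r W * lead_block r r W = lead_block r r W"
      using lead_block_sandwich_mult[OF r, of W W r r] r by simp
  qed
  have block: "lead_block r r ?Z = lead_block r r X * lead_block r r Y"
    using r by (intro lead_block_sandwich_mult Xc Yc) auto
  show "?Z \<in> ?S"
  proof (cases "det (lead_block r r X) = 0 \<or> det (lead_block r r Y) = 0")
    case True
    then have "det (lead_block r r ?Z) = 0"
      using det_mult[of "lead_block r r X" r "lead_block r r Y"] by (auto simp: block)
    then show ?thesis using Z by simp
  next
    case False
    have "sandwich_mult m n r ?Z ?Z = lead_block m r X * lead_block r r Y
        * (lead_block r r X * lead_block r n Y)"
      using r Xc Yc by (simp add: sandwich_mult_eq[OF r Zc Zc] lead_block_sandwich_mult)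
    also have "\<dots> = ?Z"
      using False XY one[of X] one[of Y] right_mult_one_mat[OF lead_block_carrier, of m r X]
        left_mult_one_mat[OF lead_block_carrier, of r n Y] by (simp add: sandwich_mult_eq[OF r Xc Yc])
    finally show ?thesis using Z by simp
  qed
qed

section \<open>Lifting idempotent factorisations to the sandwich semigroup\<close>

lemma lead_block_unital_product:
  fixes L B K :: "'a::field mat"
  assumes L: "L \<in> carrier_mat m r" "lead_block r r L = 1\<^sub>m r"
    and B: "B \<in> carrier_mat r r"
    and K: "K \<in> carrier_mat r n" "lead_block r r K = 1\<^sub>m r"
    and r: "r \<le> min m n"
  shows "lead_block m r (L * B * K) = L * B" "lead_block r n (L * B * K) = B * K"
    "L * B * K \<in> carrier_mat m n"
proof -
  have LB: "L * B \<in> carrier_mat m r" using mult_carrier_mat[OF L(1) B] .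
  show "lead_block m r (L * B * K) = L * B"
    using lead_block_mult[OF LB K(1), of m r] r by (simp add: K(2) lead_block_id[OF LB] right_mult_one_mat[OF LB])
  show "lead_block r n (L * B * K) = B * K"
    using lead_block_mult[OF LB K(1), of r n] lead_block_mult[OF L(1) B, of r r] r K(1) B
    by (simp add: L(2) lead_block_id)
  show "L * B * K \<in> carrier_mat m n" using mult_carrier_mat[OF LB K(1)] .
qed

text \<open>An idempotent \<open>E\<close> lifts to the idempotent \<open>L E K\<close>. A product
  splits as \<open>L B1 B2 K = (L B1 K0) \<star> (L0 B2 K)\<close>, which is why \<open>L\<close>
  and \<open>K\<close> vary in the induction.\<close>

lemma idem_prods_in_subsemigroup:
  fixes T :: "'a::field mat set"
  assumes T: "sandwich_subsemigroup m n r T" "sandwich_E m n r (carrier_mat m n) \<subseteq> T"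
    and r: "r \<le> min m n"
    and "B \<in> idem_prods r"
    and "L \<in> carrier_mat m r" "lead_block r r L = 1\<^sub>m r"
    and "K \<in> carrier_mat r n" "lead_block r r K = 1\<^sub>m r"
  shows "L * B * K \<in> T"
  using assms(4-)
proof (induction B arbitrary: L K rule: idem_prods.induct)
  case (idem E)
  note LEK = lead_block_unital_product[OF idem(3,4,1,5,6) r]
  have LE: "L * E \<in> carrier_mat m r" using mult_carrier_mat[OF idem(3,1)] .
  have "sandwich_mult m n r (L * E * K) (L * E * K) = L * E * (E * K)"
    using sandwich_mult_eq[OF r LEK(3,3)] LEK(1,2) by simp
  also have "\<dots> = L * (E * E) * K"
    using assoc_mult_mat[OF LE idem(1,5)] assoc_mult_mat[OF idem(3,1,1)] by simp
  finally have "L * E * K \<in> sandwich_E m n r (carrier_mat m n)"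
    using LEK(3) idem(2) by (simp add: sandwich_E_def)
  then show ?case using T(2) by blast
next
  case (mult B1 B2)
  define L0 K0 :: "'a mat" where "L0 = mat m r (\<lambda>(i, j). if i = j then 1 else 0)"
    and "K0 = mat r n (\<lambda>(i, j). if i = j then 1 else 0)"
  have L0: "L0 \<in> carrier_mat m r" "lead_block r r L0 = 1\<^sub>m r"
    using r by (auto simp: L0_def intro!: eq_matI)
  have K0: "K0 \<in> carrier_mat r n" "lead_block r r K0 = 1\<^sub>m r"
    using r by (auto simp: K0_def intro!: eq_matI)
  note B = mult(1,2)[THEN idem_prods_carrier]
  have LB: "L * B1 \<in> carrier_mat m r" using mult_carrier_mat[OF mult(5) B(1)] .
  note 1 = lead_block_unital_product[OF mult(5,6) B(1) K0 r]
    and 2 = lead_block_unital_product[OF L0 B(2) mult(7,8) r]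
  have "L * B1 * K0 \<in> T" "L0 * B2 * K \<in> T"
    using mult.IH mult.prems L0 K0 by blast+
  then have "sandwich_mult m n r (L * B1 * K0) (L0 * B2 * K) \<in> T"
    using T(1) by (simp add: sandwich_subsemigroup_def)
  also have "sandwich_mult m n r (L * B1 * K0) (L0 * B2 * K) = L * B1 * (B2 * K)"
    using sandwich_mult_eq[OF r 1(3) 2(3)] 1(1) 2(2) by simp
  also have "\<dots> = L * (B1 * B2) * K"
    using assoc_mult_mat[OF LB B(2) mult(7)] assoc_mult_mat[OF mult(5) B] by simp
  finally show ?case .
qed

lemma singular_in_subsemigroup:
  fixes X :: "'a::field mat"
  assumes T: "sandwich_subsemigroup m n r T" "sandwich_E m n r (carrier_mat m n) \<subseteq> T"
    and r: "r \<le> min m n"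
    and X: "X \<in> sandwich_Reg m n r" "det (lead_block r r X) = 0"
  shows "X \<in> T"
proof -
  let ?C = "lead_block m r X" and ?R = "lead_block r n X" and ?A = "lead_block r r X"
  obtain E where E: "E \<in> carrier_mat r r" "X = ?C * E * ?R" "?C = ?C * E * ?A" "?R = ?A * E * ?R"
    by (rule sandwich_Reg_factors[OF r X(1)])
  \<comment> \<open>The leading block of \<open>C E\<close> need not be the identity, so its first
    \<open>r\<close> rows are replaced by it. Still \<open>L A = C\<close>: the first
    \<open>r\<close> rows give \<open>A\<close>, the others follow from \<open>C E A = C\<close>.
    The matrix \<open>K\<close> is the dual construction.\<close>
  define L where "L = mat m r (\<lambda>(i, j). if i < r then (if i = j then 1 else 0) else (?C * E) $$ (i, j))"
  define K where "K = mat r n (\<lambda>(i, j). if j < r then (if i = j then 1 else 0) else (E * ?R) $$ (i, j))"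
  have L: "L \<in> carrier_mat m r" "lead_block r r L = 1\<^sub>m r"
    using r by (auto simp: L_def intro!: eq_matI)
  have K: "K \<in> carrier_mat r n" "lead_block r r K = 1\<^sub>m r"
    using r by (auto simp: K_def intro!: eq_matI)
  have CE: "?C * E \<in> carrier_mat m r" using mult_carrier_mat[OF lead_block_carrier E(1)] .
  have ER: "E * ?R \<in> carrier_mat r n" using mult_carrier_mat[OF E(1) lead_block_carrier] .
  have AER: "?A * (E * ?R) = ?R"
    unfolding assoc_mult_mat[OF lead_block_carrier E(1) lead_block_carrier, symmetric]
    by (rule E(4)[symmetric])
  have LA: "L * ?A = ?C"
  proof (rule eq_matI, goal_cases)
    case (1 i j)
    then have ij: "i < m" "j < r" by auto
    show ?case
    proof (cases "i < r")
      case True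
      have "row L i = unit_vec r i" by (rule eq_vecI) (use True ij in \<open>auto simp: L_def\<close>)
      then show ?thesis using True ij L(1) by simp
    next
      case False
      have "row L i = row (?C * E) i"
        by (rule eq_vecI) (use False ij E(1) in \<open>auto simp: L_def\<close>)
      then have "(L * ?A) $$ (i, j) = (?C * E * ?A) $$ (i, j)" using ij L(1) CE by simp
      then show ?thesis by (simp only: E(3)[symmetric])
    qed
  qed (use L in auto)
  have AK: "?A * K = ?R"
  proof (rule eq_matI, goal_cases)
    case (1 i j)
    then have ij: "i < r" "j < n" by auto
    show ?case
    proof (cases "j < r")
      case True
      have "col K j = unit_vec r j" by (rule eq_vecI) (use True ij in \<open>auto simp: K_def\<close>)
      then show ?thesis using True ij K(1) by simp
    next
      case False
      have "col K j = col (E * ?R) j"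
        by (rule eq_vecI) (use False ij E(1) in \<open>auto simp: K_def\<close>)
      then have "(?A * K) $$ (i, j) = (?A * (E * ?R)) $$ (i, j)" using ij K(1) ER by simp
      then show ?thesis by (simp only: AER)
    qed
  qed (use K in auto)
  \<comment> \<open>Hence \<open>L A K = C K = C E (A K) = C E R = X\<close>.\<close>
  have "L * ?A * K = ?C * E * ?A * K" by (simp only: LA E(3)[symmetric])
  also have "\<dots> = X" by (simp only: assoc_mult_mat[OF CE lead_block_carrier K(1)] AK E(2)[symmetric])
  finally show ?thesis
    using idem_prods_in_subsemigroup[OF T r singular_imp_idem_prods[OF lead_block_carrier X(2)] L K]
    by simp
qed

theorem theorem7p3:
  fixes m n r :: nat
  assumes "m \<ge> 1" and "n \<ge> 1" and "r \<le> min m n"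
    and "r \<ge> 1" and "\<not> (r = m \<and> m = n)"
  shows "(sandwich_idem_gen m n r :: 'a::field mat set) =
           (sandwich_Reg m n r - sandwich_D m n r) \<union> sandwich_E m n r (sandwich_D m n r)"
proof -
  note r = assms(3)
  \<comment> \<open>The right-hand side restated by leading blocks: a regular element lies outside
    \<open>D\<close> iff its block is singular.\<close>
  let ?S = "{X \<in> sandwich_Reg m n r. det (lead_block r r X) = (0::'a) \<or> X = sandwich_mult m n r X X}"
  have E: "sandwich_E m n r (carrier_mat m n) \<subseteq> (sandwich_Reg m n r :: 'a mat set)"
  proof
    fix X :: "'a mat" assume "X \<in> sandwich_E m n r (carrier_mat m n)"
    then have "X \<in> carrier_mat m n" "X = sandwich_mult m n r X X" by (auto simp: sandwich_E_def)
    then show "X \<in> sandwich_Reg m n r"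
      unfolding sandwich_Reg_def by (intro CollectI conjI bexI[of _ X]) simp_all
  qed
  have "(sandwich_Reg m n r - sandwich_D m n r) \<union> sandwich_E m n r (sandwich_D m n r) = ?S"
    using rank_sandwich_Reg[OF r, where 'a = 'a] by (auto simp: sandwich_D_def sandwich_E_def)
  moreover have "sandwich_idem_gen m n r = ?S"
    unfolding sandwich_idem_gen_def
  proof (rule hull_unique)
    show "sandwich_E m n r (carrier_mat m n) \<subseteq> ?S" using E by (auto simp: sandwich_E_def)
    show "sandwich_subsemigroup m n r ?S" by (rule subsemigroup_singular_or_idempotent[OF r])
    fix T :: "'a mat set"
    assume "sandwich_E m n r (carrier_mat m n) \<subseteq> T" "sandwich_subsemigroup m n r T"
    \<comment> \<open>Elements with singular block come from the lifting; the remaining ones are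
      idempotents, hence generators.\<close>
    then show "?S \<subseteq> T"
      using singular_in_subsemigroup[OF _ _ r] by (auto simp: sandwich_E_def sandwich_Reg_carrier)
  qed
  ultimately show ?thesis by simp
qed

end
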